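(* Let $G$ be a finite group. If $\min\{s,t\}>1$ and there exists an $(s,t)$-$\lambda$-fold near-factorization of $G$, then $\lambda\le\min\{s-1,t-1\}$.
   Context: For subsets $S,T$ of a finite group $G$ with identity $e$, and a positive integer $\lambda$, $(S,T)$ is a $\lambda$-fold near-factorization of $G$ if every non-identity element $g\in G$ can be written as $g=xy$ with $x\in S$, $y\in T$ in exactly $\lambda$ ways, and $xy\neq e$ for all $x\in S$, $y\in T$. It is an $(s,t)$-$\lambda$-fold near-factorization if moreover $|S|=s$ and $|T|=t$. *)

theory Defs
  imports "HOL-Algebra.Group"
begin

(* The number of ways to write g as a product is the number of pairs (x, y) \<in> S \<times> T
   with x \<otimes> y = g; for finite G these sets are finite, so card counts them. *)
definition near_factorization ::
  "('a, 'b) monoid_scheme \<Rightarrow> nat \<Rightarrow> 'a set \<Rightarrow> 'a set \<Rightarrow> bool"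
where
  "near_factorization G l S T \<longleftrightarrow>
     0 < l \<and> S \<subseteq> carrier G \<and> T \<subseteq> carrier G \<and>
     (\<forall>g \<in> carrier G - {\<one>\<^bsub>G\<^esub>}. card {(x, y) \<in> S \<times> T. x \<otimes>\<^bsub>G\<^esub> y = g} = l) \<and>
     (\<forall>x \<in> S. \<forall>y \<in> T. x \<otimes>\<^bsub>G\<^esub> y \<noteq> \<one>\<^bsub>G\<^esub>)"

definition near_factorization_card ::
  "('a, 'b) monoid_scheme \<Rightarrow> nat \<Rightarrow> nat \<Rightarrow> nat \<Rightarrow> 'a set \<Rightarrow> 'a set \<Rightarrow> bool"
where
  "near_factorization_card G s t l S T \<longleftrightarrow>
     near_factorization G l S T \<and> card S = s \<and> card T = t"

end

(* Counting products gives s t = l (n - 1) with n = |G|. Since the identity is not a product,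
   T is disjoint from the inverses of S, so s + t \<le> n. Hence t \<le> n - s < n - 1 when s > 1,
   and l (n - 1) = s t < s (n - 1) forces l < s; the bound l < t is symmetric. *)
theory Submission
  imports Defs
begin

text \<open>Double counting of \<open>S \<times> T\<close>: its pairs split into the fibres of the
  product map, one of size \<open>l\<close> over each non-identity element.\<close>

lemma near_factorization_card_mult:
  assumes "group G" and fin: "finite (carrier G)" and nf: "near_factorization G l S T"
  shows "card S * card T = l * (card (carrier G) - 1)"
proof -
  interpret group G by fact
  let ?C = "carrier G - {\<one>\<^bsub>G\<^esub>}"
  let ?m = "\<lambda>(x, y). x \<otimes>\<^bsub>G\<^esub> y"
  have sub: "S \<subseteq> carrier G" "T \<subseteq> carrier G"
    and ways: "\<And>g. g \<in> ?C \<Longrightarrow> card {(x, y) \<in> S \<times> T. x \<otimes>\<^bsub>G\<^esub> y = g} = l"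
    and no_one: "\<And>x y. x \<in> S \<Longrightarrow> y \<in> T \<Longrightarrow> x \<otimes>\<^bsub>G\<^esub> y \<noteq> \<one>\<^bsub>G\<^esub>"
    using nf unfolding near_factorization_def by blast+
  have finite: "finite (S \<times> T)"
    using sub fin finite_subset by blast
  \<comment> \<open>No pair lies over the identity, so the fibres over \<open>?C\<close> exhaust
    \<open>S \<times> T\<close>; \<open>sum.group\<close> needs exactly this.\<close>
  have "?m ` (S \<times> T) \<subseteq> ?C"
    using sub no_one by auto
  then have "(\<Sum>g\<in>?C. \<Sum>p\<in>{p \<in> S \<times> T. ?m p = g}. 1) = (\<Sum>p\<in>S \<times> T. 1::nat)"
    using fin finite by (intro sum.group) auto
  moreover have "card {p \<in> S \<times> T. ?m p = g} = l" if "g \<in> ?C" for g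
  proof -
    have "{p \<in> S \<times> T. ?m p = g} = {(x, y) \<in> S \<times> T. x \<otimes>\<^bsub>G\<^esub> y = g}"
      by auto
    with ways[OF that] show ?thesis
      by simp
  qed
  ultimately have "card S * card T = card ?C * l"
    by (simp add: card_cartesian_product)
  then show ?thesis
    by (simp add: fin mult.commute)
qed

lemma near_factorization_card_add_le:
  assumes "group G" and fin: "finite (carrier G)" and nf: "near_factorization G l S T"
  shows "card S + card T \<le> card (carrier G)"
proof -
  interpret group G by fact
  have sub: "S \<subseteq> carrier G" "T \<subseteq> carrier G"
    and no_one: "\<And>x y. x \<in> S \<Longrightarrow> y \<in> T \<Longrightarrow> x \<otimes>\<^bsub>G\<^esub> y \<noteq> \<one>\<^bsub>G\<^esub>"
    using nf unfolding near_factorization_def by blast+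
  let ?I = "m_inv G ` S"
  have "inj_on (m_inv G) S"
    using inv_inj sub(1) inj_on_subset by blast
  then have "card ?I = card S"
    by (rule card_image)
  \<comment> \<open>If the inverse of some \<open>x \<in> S\<close> were in \<open>T\<close>, then
    \<open>x\<close> times it would be a forbidden product equal to the identity.\<close>
  moreover have "?I \<inter> T = {}"
    using no_one sub r_inv by fastforce
  moreover have "finite ?I" "finite T"
    using sub fin finite_subset by blast+
  ultimately have "card S + card T = card (?I \<union> T)"
    by (simp add: card_Un_disjoint)
  also have "\<dots> \<le> card (carrier G)"
    using sub fin by (intro card_mono) auto
  finally show ?thesis .
qed

theorem corollary1p17:
  fixes G :: "('a, 'b) monoid_scheme" and s t l :: nat
  assumes "group G"
    and "finite (carrier G)"
    and "min s t > 1"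
    and "\<exists>S T. near_factorization_card G s t l S T"
  shows "l \<le> min (s - 1) (t - 1)"
proof -
  let ?n = "card (carrier G)"
  obtain S T where nf: "near_factorization G l S T" and "card S = s" "card T = t"
    using assms(4) unfolding near_factorization_card_def by blast
  then have mult: "s * t = l * (?n - 1)" and add: "s + t \<le> ?n"
    using near_factorization_card_mult[OF assms(1,2) nf]
      near_factorization_card_add_le[OF assms(1,2) nf] by auto
  \<comment> \<open>After rewriting the left side to \<open>s * t\<close>, the claim reduces to
    \<open>t < ?n - 1\<close>. This is strict because \<open>s \<ge> 2\<close> gives
    \<open>t \<le> ?n - 2\<close>.\<close>
  have "l * (?n - 1) < s * (?n - 1)"
    unfolding mult[symmetric] using assms(3) add by (intro mult_strict_left_mono) auto
  moreover have "l * (?n - 1) < t * (?n - 1)"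
    \<comment> \<open>Commuting puts \<open>t\<close> in front as the common factor, leaving
      \<open>s < ?n - 1\<close>, which follows from \<open>t \<ge> 2\<close>.\<close>
    unfolding mult[symmetric] mult.commute[of s t]
    using assms(3) add by (intro mult_strict_left_mono) auto
  ultimately have "l < s" "l < t"
    by simp_all
  then show ?thesis
    by linarith
qed

end
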